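(* Let $E:=\{\lambda\in\mathbb{C}:|\lambda|<1\}$ and let $\mathbb{G}_2:=\{(\lambda_1+\lambda_2,\lambda_1\lambda_2):\lambda_1,\lambda_2\in E\}\subset\mathbb{C}^2$ be the symmetrized bidisc. For $h\in\operatorname{Aut}(E)$ let $H_h:\mathbb{G}_2\to\mathbb{G}_2$ be the map determined by $H_h(\lambda_1+\lambda_2,\lambda_1\lambda_2)=(h(\lambda_1)+h(\lambda_2),h(\lambda_1)h(\lambda_2))$ for all $\lambda_1,\lambda_2\in E$. Then $$\operatorname{Aut}(\mathbb{G}_2)=\{H_h: h\in\operatorname{Aut}(E)\}.$$
   Context: For a domain $D\subset\mathbb{C}^n$, $\operatorname{Aut}(D)$ denotes the group of all biholomorphic maps $D\to D$. Put $\pi:\mathbb{C}^2\to\mathbb{C}^2$, $\pi(\lambda_1,\lambda_2):=(\lambda_1+\lambda_2,\lambda_1\lambda_2)$, so that $\mathbb{G}_2=\pi(E^2)$, where $E$ is the open unit disc; $\mathbb{G}_2$ is a domain in $\mathbb{C}^2$. For a holomorphic map $h:E\to E$, the relation $H_h(\pi(\lambda_1,\lambda_2))=\pi(h(\lambda_1),h(\lambda_2))$, $\lambda_1,\lambda_2\in E$, gives a well-defined holomorphic map $H_h:\mathbb{G}_2\to\mathbb{G}_2$ (the right-hand side is symmetric in $\lambda_1,\lambda_2$). *)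

theory Defs
  imports "HOL-Complex_Analysis.Complex_Analysis"
begin

text \<open>
  Holomorphy in several variables as Frechet differentiability with a complex-linear derivative:
  \<open>has_derivative\<close> only gives a real-linear one. The sets \<open>D\<close> below are meant to be open.
\<close>

definition holomorphic_map_on :: "(complex^'n \<Rightarrow> complex^'m) \<Rightarrow> (complex^'n) set \<Rightarrow> bool" where
  "holomorphic_map_on f D \<longleftrightarrow>
     (\<forall>z\<in>D. \<exists>f'. (f has_derivative f') (at z) \<and> (\<forall>c v. f' (c *s v) = c *s f' v))"

text \<open>
  A map with domain \<open>D\<close> is represented by the total function that is \<open>undefined\<close> outside
  \<open>D\<close>, so that equality of functions is equality of maps on \<open>D\<close>.
\<close>

definition Aut :: "(complex^'n) set \<Rightarrow> (complex^'n \<Rightarrow> complex^'n) set" where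
  "Aut D = {f \<in> extensional D. bij_betw f D D \<and>
     holomorphic_map_on f D \<and> holomorphic_map_on (inv_into D f) D}"

text \<open>The case of one variable, with the library's notion of holomorphy on \<open>complex\<close>.\<close>

definition Aut1 :: "complex set \<Rightarrow> (complex \<Rightarrow> complex) set" where
  "Aut1 D = {f \<in> extensional D. bij_betw f D D \<and>
     f holomorphic_on D \<and> inv_into D f holomorphic_on D}"

definition unit_disc :: "complex set" where
  "unit_disc = {z. cmod z < 1}"

definition sym_pi :: "complex \<Rightarrow> complex \<Rightarrow> complex^2" where
  "sym_pi l1 l2 = vector [l1 + l2, l1 * l2]"

definition G2 :: "(complex^2) set" where
  "G2 = {sym_pi l1 l2 | l1 l2. l1 \<in> unit_disc \<and> l2 \<in> unit_disc}"

definition H :: "(complex \<Rightarrow> complex) \<Rightarrow> complex^2 \<Rightarrow> complex^2" where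
  "H h = restrict (\<lambda>z. THE w. \<exists>l1\<in>unit_disc. \<exists>l2\<in>unit_disc.
           z = sym_pi l1 l2 \<and> w = sym_pi (h l1) (h l2)) G2"

lemma sym_pi_eq_iff:
  "sym_pi a b = sym_pi c d \<longleftrightarrow> (a = c \<and> b = d) \<or> (a = d \<and> b = c)"
proof
  assume "sym_pi a b = sym_pi c d"
  then have s: "a + b = c + d" and p: "a * b = c * d"
    by (auto simp: sym_pi_def vec_eq_iff forall_2)
  have b: "b = c + d - a"
    using s by (simp add: algebra_simps)
  have "(a - c) * (a - d) = 0"
    using p unfolding b by (simp add: algebra_simps)
  then show "(a = c \<and> b = d) \<or> (a = d \<and> b = c)"
    using s by auto
qed (auto simp: sym_pi_def add.commute mult.commute)

text \<open>The description in \<^const>\<open>H\<close> is well-defined and yields the intended relation.\<close>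

lemma H_sym_pi:
  assumes "l1 \<in> unit_disc" "l2 \<in> unit_disc"
  shows "H h (sym_pi l1 l2) = sym_pi (h l1) (h l2)"
proof -
  have "sym_pi l1 l2 \<in> G2"
    using assms by (auto simp: G2_def)
  moreover have "(THE w. \<exists>k1\<in>unit_disc. \<exists>k2\<in>unit_disc.
      sym_pi l1 l2 = sym_pi k1 k2 \<and> w = sym_pi (h k1) (h k2)) = sym_pi (h l1) (h l2)"
    by (rule the_equality) (use assms in \<open>auto simp: sym_pi_eq_iff\<close>)
  ultimately show ?thesis
    by (simp add: H_def)
qed

end

theory Submission
  imports Defs
begin

text \<open>
  A point of \<open>G2\<close> is an unordered pair of points of the disc, the roots of \<open>t\<^sup>2 - x\<^sub>1 t + x\<^sub>2\<close>.
  An automorphism \<open>F\<close> sends pairs with a common root to pairs with a common root: the resultant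
  of \<open>F(\<pi>(z, w))\<close> and \<open>F(\<pi>(z', w))\<close> is holomorphic in \<open>w\<close>, and it tends to 0 as \<open>|w| \<rightarrow> 1\<close>,
  because by Montel's theorem the discs \<open>F(\<pi>(\<cdot>, w))\<close> accumulate at analytic discs in the boundary
  of \<open>G2\<close>, all of whose points share a unimodular root. For fixed \<open>w\<close> the pairs
  \<open>F(\<pi>(z, w))\<close> therefore form an infinite intersecting family, so they have a common element
  \<open>h(w)\<close>, and \<open>F = H h\<close>.

  Conversely, by Schwarz' lemma \<open>h\<close> is a Moebius function, so \<open>H h\<close> is a quotient of affine
  functions.
\<close>

no_notation fps_nth (infixl \<open>$\<close> 75)

section \<open>Geometry of the symmetrized bidisc\<close>

lemma unit_disc_eq_ball: "unit_disc = ball 0 1"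
  by (auto simp: unit_disc_def)

lemma sym_pi_nth [simp]: "sym_pi a b $ 1 = a + b" "sym_pi a b $ 2 = a * b"
  by (simp_all add: sym_pi_def)

lemma sym_pi_commute: "sym_pi a b = sym_pi b a"
  by (simp add: sym_pi_eq_iff)

lemma sym_pi_in_G2: "a \<in> unit_disc \<Longrightarrow> b \<in> unit_disc \<Longrightarrow> sym_pi a b \<in> G2"
  by (auto simp: G2_def)

text \<open>Roots are collected without multiplicity. Nothing is lost: a monic quadratic with a
  single root has it twice.\<close>

definition root_set :: "complex^2 \<Rightarrow> complex set" where
  "root_set x = {c. c\<^sup>2 - x $ 1 * c + x $ 2 = 0}"

lemma root_set_sym_pi [simp]: "root_set (sym_pi a b) = {a, b}"
proof -
  have "c\<^sup>2 - (a + b) * c + a * b = (c - a) * (c - b)" for c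
    by (simp add: algebra_simps power2_eq_square)
  then show ?thesis
    by (auto simp: root_set_def)
qed

lemma root_set_subset: "x \<in> G2 \<Longrightarrow> root_set x \<subseteq> unit_disc"
  by (auto simp: G2_def)

lemma root_set_inj: "x \<in> G2 \<Longrightarrow> y \<in> G2 \<Longrightarrow> root_set x = root_set y \<Longrightarrow> x = y"
  by (auto simp: G2_def doubleton_eq_iff sym_pi_eq_iff)

text \<open>The quadratic formula. It also covers points outside \<open>G2\<close>, so that
  membership in \<open>G2\<close> becomes a condition on roots alone.\<close>

lemma exists_sym_pi: "\<exists>a b. x = sym_pi a b"
proof -
  define d where "d = csqrt ((x $ 1)\<^sup>2 - 4 * x $ 2)"
  have d: "d\<^sup>2 = (x $ 1)\<^sup>2 - 4 * x $ 2"
    by (simp add: d_def)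
  have "x = sym_pi ((x $ 1 + d) / 2) ((x $ 1 - d) / 2)"
  proof -
    have "((x $ 1 + d) / 2) * ((x $ 1 - d) / 2) = ((x $ 1)\<^sup>2 - d\<^sup>2) / 4"
      by (simp add: power2_eq_square algebra_simps)
    then show ?thesis
      by (simp add: vec_eq_iff forall_2 d field_simps)
  qed
  then show ?thesis by blast
qed

lemma sym_pi_of_root:
  assumes "x \<in> G2" "v \<in> root_set x"
  shows "\<exists>b\<in>unit_disc. x = sym_pi v b"
proof -
  obtain a b where ab: "x = sym_pi a b" "a \<in> unit_disc" "b \<in> unit_disc"
    using assms(1) by (auto simp: G2_def)
  with assms(2) show ?thesis
    using sym_pi_commute by auto
qed

lemma G2_iff_root_set: "x \<in> G2 \<longleftrightarrow> root_set x \<subseteq> unit_disc"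
  using exists_sym_pi[of x] sym_pi_in_G2 root_set_subset by auto

text \<open>The roots are replaced by their reciprocals, so that the roots outside the disc range
  over a compact set.\<close>

lemma open_G2: "open G2"
proof -
  have "- G2 = {x. \<exists>u. u \<in> cball 0 1 \<and> (u, x) \<in> {(u, x). 1 - x $ 1 * u + x $ 2 * u\<^sup>2 = 0}}"
    (is "_ = ?R")
  proof (intro set_eqI iffI)
    fix x assume "x \<in> - G2"
    then have "\<not> root_set x \<subseteq> unit_disc"
      by (simp add: G2_iff_root_set)
    then obtain c where c: "c\<^sup>2 - x $ 1 * c + x $ 2 = 0" "cmod c \<ge> 1"
      unfolding root_set_def unit_disc_def by (metis (mono_tags, lifting) mem_Collect_eq not_less subsetI)
    then have "c \<noteq> 0" by auto
    have "1 - x $ 1 * inverse c + x $ 2 * (inverse c)\<^sup>2 = (c\<^sup>2 - x $ 1 * c + x $ 2) * (inverse c)\<^sup>2"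
      using \<open>c \<noteq> 0\<close> by (simp add: field_simps power2_eq_square)
    moreover have "inverse c \<in> cball 0 1"
      using c(2) by (simp add: norm_inverse inverse_le_1_iff)
    ultimately show "x \<in> ?R"
      using c(1) by auto
  next
    fix x assume "x \<in> ?R"
    then obtain u where u: "1 - x $ 1 * u + x $ 2 * u\<^sup>2 = 0" "cmod u \<le> 1"
      by auto
    then have "u \<noteq> 0" by auto
    have "(inverse u)\<^sup>2 - x $ 1 * inverse u + x $ 2 = (1 - x $ 1 * u + x $ 2 * u\<^sup>2) * (inverse u)\<^sup>2"
      using \<open>u \<noteq> 0\<close> by (simp add: field_simps power2_eq_square)
    then have "inverse u \<in> root_set x"
      using u(1) by (simp add: root_set_def)
    moreover have "inverse u \<notin> unit_disc"
      using u(2) \<open>u \<noteq> 0\<close> by (simp add: unit_disc_def norm_inverse inverse_less_1_iff)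
    ultimately show "x \<in> - G2"
      by (auto simp: G2_iff_root_set)
  qed
  moreover have "closed {(u :: complex, x :: complex^2). 1 - x $ 1 * u + x $ 2 * u\<^sup>2 = 0}"
    unfolding case_prod_unfold by (intro closed_Collect_eq continuous_intros)
  then have "closed ?R"
    by (intro closed_compact_projection compact_cball)
  ultimately have "closed (- G2)"
    by simp
  then show ?thesis
    by (simp add: closed_def)
qed

section \<open>The closed symmetrized bidisc\<close>

lemma tendsto_sym_pi:
  assumes "(f \<longlongrightarrow> a) F" "(g \<longlongrightarrow> b) F"
  shows "((\<lambda>z. sym_pi (f z) (g z)) \<longlongrightarrow> sym_pi a b) F"
proof (rule vec_tendstoI)
  fix i :: 2
  show "((\<lambda>z. sym_pi (f z) (g z) $ i) \<longlongrightarrow> sym_pi a b $ i) F"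
    using exhaust_2[of i]
    by (elim disjE) (simp_all only: sym_pi_nth tendsto_add[OF assms] tendsto_mult[OF assms])
qed

lemma closed_sym_pi_cball: "closed ((\<lambda>(a, b). sym_pi a b) ` (cball 0 1 \<times> cball 0 1))"
proof (rule compact_imp_closed, rule compact_continuous_image)
  show "continuous_on (cball 0 1 \<times> cball 0 1) (\<lambda>(a, b). sym_pi a b)"
    unfolding continuous_on_def case_prod_unfold
    by (intro ballI tendsto_sym_pi tendsto_fst tendsto_snd tendsto_ident_at)
qed (intro compact_Times compact_cball)

text \<open>The map \<open>c\<close> to \<open>1 / (1 - c)\<close> sends the closed disc without 1
  into the half-plane \<open>Re \<ge> 1/2\<close>. In terms of the images \<open>u\<close>,
  \<open>v\<close> of \<open>a\<close>, \<open>b\<close> the claim reads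
  \<open>cmod (u + v - 2) \<le> cmod (u + v)\<close>, that is,
  \<open>Re (u + v) \<ge> 1\<close>.\<close>

lemma norm_sym_pi_cball_le:
  assumes "cmod a \<le> 1" "cmod b \<le> 1"
  shows "cmod (2 * (a * b) - (a + b)) \<le> cmod (2 - (a + b))"
proof (cases "a = 1 \<or> b = 1")
  case True
  then show ?thesis
    by (auto simp: algebra_simps norm_minus_commute)
next
  case False
  define u v where "u = inverse (1 - a)" and "v = inverse (1 - b)"
  have half: "Re (inverse (1 - c)) \<ge> 1 / 2" if "cmod c \<le> 1" "c \<noteq> 1" for c
  proof -
    have "(Re c)\<^sup>2 + (Im c)\<^sup>2 \<le> 1"
      using that(1) by (metis cmod_power2 norm_ge_zero power_le_one)
    moreover have "(1 - Re c)\<^sup>2 + (Im c)\<^sup>2 > 0"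
      using that(2) by (auto simp: complex_eq_iff sum_power2_gt_zero_iff)
    ultimately show ?thesis
      unfolding inverse_complex.simps by (simp add: field_simps power2_eq_square)
  qed
  have u: "a * u = u - 1" "u \<noteq> 0" and v: "b * v = v - 1" "v \<noteq> 0"
    using False by (auto simp: u_def v_def divide_simps)
  have "Re u \<ge> 1 / 2" "Re v \<ge> 1 / 2"
    using half[of a] half[of b] assms False by (auto simp: u_def v_def)
  then have "(cmod (u + v - 2))\<^sup>2 \<le> (cmod (u + v))\<^sup>2"
    unfolding cmod_power2 by (simp add: power2_eq_square algebra_simps)
  then have "cmod (u + v - 2) \<le> cmod (u + v)"
    by (rule power2_le_imp_le) simp
  moreover have "(2 * (a * b) - (a + b)) * (u * v) = 2 * ((a * u) * (b * v)) - (a * u) * v - u * (b * v)"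
    "(2 - (a + b)) * (u * v) = 2 * (u * v) - (a * u) * v - u * (b * v)"
    by (simp_all add: algebra_simps)
  then have "(2 * (a * b) - (a + b)) * (u * v) = - (u + v - 2)" "(2 - (a + b)) * (u * v) = u + v"
    unfolding u v by (simp_all add: algebra_simps)
  ultimately have "cmod (2 * (a * b) - (a + b)) * cmod (u * v) \<le> cmod (2 - (a + b)) * cmod (u * v)"
    unfolding norm_mult[symmetric] by (simp only: norm_minus_cancel)
  then show ?thesis
    using u v by (simp add: mult_le_cancel_right)
qed

section \<open>Boundary discs\<close>

lemma max_modulus_attained_imp_constant:
  assumes "f holomorphic_on ball 0 1" "z0 \<in> ball 0 1" "z \<in> ball 0 1"
    and "\<And>z. z \<in> ball 0 1 \<Longrightarrow> cmod (f z) \<le> cmod (f z0)"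
  shows "f z = f z0"
  using maximum_modulus_principle[OF assms(1) open_ball connected_ball open_ball order_refl assms(2,4)]
    assms(2,3) by (auto simp: constant_on_def)

text \<open>The maximum modulus principle on slightly smaller balls: uniform decay towards the unit
  circle takes the place of a continuous extension to it.\<close>

lemma holomorphic_on_ball_vanishing_boundary:
  assumes hol: "f holomorphic_on ball 0 1"
    and lim: "\<And>e. e > 0 \<Longrightarrow> \<exists>r<1. \<forall>w. r < cmod w \<and> cmod w < 1 \<longrightarrow> cmod (f w) < e"
    and "w0 \<in> ball 0 1"
  shows "f w0 = 0"
proof -
  have "cmod (f w0) \<le> e" if "e > 0" for e
  proof -
    from lim[OF that] obtain r where r: "r < 1" "\<And>w. r < cmod w \<Longrightarrow> cmod w < 1 \<Longrightarrow> cmod (f w) < e"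
      by auto
    \<comment> \<open>The circle of radius \<open>R\<close> encloses \<open>w0\<close> and lies in
      the zone where \<open>f\<close> is smaller than \<open>e\<close>.\<close>
    define R where "R = (max r (cmod w0) + 1) / 2"
    have R: "r < R" "cmod w0 < R" "R < 1"
      using r(1) assms(3) by (auto simp: R_def)
    then have "R > 0"
      using norm_ge_zero le_less_trans by blast
    show ?thesis
    proof (rule maximum_modulus_frontier[of f "ball 0 R"])
      show "f holomorphic_on interior (ball 0 R)"
        using R by (auto intro!: holomorphic_on_subset[OF hol])
      show "continuous_on (closure (ball 0 R)) f"
        using R \<open>R > 0\<close> by (auto intro!: holomorphic_on_imp_continuous_on holomorphic_on_subset[OF hol])
      show "cmod (f z) \<le> e" if "z \<in> frontier (ball 0 R)" for z
        using that R \<open>R > 0\<close> r(2)[of z] by (simp add: frontier_ball)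
    qed (use R in auto)
  qed
  then have "cmod (f w0) \<le> 0"
    by (rule field_le_epsilon) simp
  then show ?thesis by simp
qed

text \<open>If 1 is a root of \<open>t\<^sup>2 - \<sigma> t + \<rho>\<close> at one point, it is a root everywhere: the function
  \<open>(2\<rho> - \<sigma>) / (2 - \<sigma>)\<close> is bounded by 1 and takes the value \<open>-1\<close> at \<open>z0\<close>.\<close>

lemma boundary_disc_aux:
  fixes \<sigma> \<rho> :: "complex \<Rightarrow> complex"
  assumes hol: "\<sigma> holomorphic_on ball 0 1" "\<rho> holomorphic_on ball 0 1"
    and cl: "\<And>z. z \<in> ball 0 1 \<Longrightarrow> \<exists>a b. cmod a \<le> 1 \<and> cmod b \<le> 1 \<and> \<sigma> z = a + b \<and> \<rho> z = a * b"
    and z0: "z0 \<in> ball 0 1" "\<rho> z0 = \<sigma> z0 - 1"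
    and z: "z \<in> ball 0 1"
  shows "\<rho> z = \<sigma> z - 1"
proof -
  have le2: "cmod (\<sigma> z) \<le> 2" if "z \<in> ball 0 1" for z
    using cl[OF that] by (metis add_mono norm_triangle_le one_add_one)
  show ?thesis
  proof (cases "\<exists>y\<in>ball 0 1. \<sigma> y = 2")
    \<comment> \<open>Here the denominator of the auxiliary quotient vanishes somewhere. But 2 is
      the largest possible modulus of \<open>\<sigma>\<close>, so \<open>\<sigma>\<close> is
      constantly 2, and two points of the closed disc with sum 2 both equal 1.\<close>
    case True
    then obtain y where y: "y \<in> ball 0 1" "\<sigma> y = 2"
      by blast
    have "\<sigma> z = 2"
      using max_modulus_attained_imp_constant[OF hol(1) y(1) z] le2 y(2) by simp
    then obtain a b where ab: "cmod a \<le> 1" "cmod b \<le> 1" "a + b = 2" "\<rho> z = a * b"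
      using cl[OF z] by auto
    have "Re a \<le> 1" "Re b \<le> 1"
      using ab complex_Re_le_cmod order_trans by blast+
    moreover have "Re a + Re b = 2"
      using ab(3) by (simp add: complex_eq_iff)
    ultimately have "Re a = 1" by simp
    moreover have "(Re a)\<^sup>2 + (Im a)\<^sup>2 \<le> 1"
      using ab(1) by (metis cmod_power2 norm_ge_zero power_le_one)
    ultimately have "a = 1"
      by (simp add: complex_eq_iff)
    then show ?thesis
      using ab \<open>\<sigma> z = 2\<close> by (simp add: algebra_simps)
  next
    case False
    define \<Phi> where "\<Phi> = (\<lambda>z. (2 * \<rho> z - \<sigma> z) / (2 - \<sigma> z))"
    have ne: "2 - \<sigma> y \<noteq> 0" if "y \<in> ball 0 1" for y
      using False that by auto
    have "\<Phi> holomorphic_on ball 0 1"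
      unfolding \<Phi>_def using ne by (intro holomorphic_intros hol) auto
    moreover have "\<Phi> z0 = -1"
      using ne[OF z0(1)] unfolding \<Phi>_def z0(2) by (simp add: divide_eq_eq)
    moreover have "cmod (\<Phi> y) \<le> 1" if y: "y \<in> ball 0 1" for y
    proof -
      obtain a b where "cmod a \<le> 1" "cmod b \<le> 1" "\<sigma> y = a + b" "\<rho> y = a * b"
        using cl[OF y] by blast
      then show ?thesis
        using norm_sym_pi_cball_le[of a b] ne[OF y] by (simp add: \<Phi>_def norm_divide)
    qed
    ultimately have "\<Phi> z = -1"
      using max_modulus_attained_imp_constant[of \<Phi> z0 z] z z0 by simp
    then show ?thesis
      using ne[OF z] by (simp add: \<Phi>_def divide_eq_eq) algebra
  qed
qed

text \<open>The equation says that \<open>\<xi>\<close> is a root of the quadratic with coefficients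
  \<open>\<sigma>\<close>, \<open>\<rho>\<close>. Dividing both roots by the unimodular
  \<open>\<xi>\<close> reduces to the root 1.\<close>

lemma boundary_disc:
  fixes \<sigma> \<rho> :: "complex \<Rightarrow> complex"
  assumes hol: "\<sigma> holomorphic_on ball 0 1" "\<rho> holomorphic_on ball 0 1"
    and cl: "\<And>z. z \<in> ball 0 1 \<Longrightarrow> \<exists>a b. cmod a \<le> 1 \<and> cmod b \<le> 1 \<and> \<sigma> z = a + b \<and> \<rho> z = a * b"
    and z0: "z0 \<in> ball 0 1" "\<rho> z0 = \<xi> * (\<sigma> z0 - \<xi>)" and \<xi>: "cmod \<xi> = 1"
    and z: "z \<in> ball 0 1"
  shows "\<rho> z = \<xi> * (\<sigma> z - \<xi>)"
proof -
  have "\<xi> \<noteq> 0" using \<xi> by auto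
  have "\<rho> z / \<xi>\<^sup>2 = \<sigma> z / \<xi> - 1"
  proof (rule boundary_disc_aux[where \<sigma> = "\<lambda>z. \<sigma> z / \<xi>" and \<rho> = "\<lambda>z. \<rho> z / \<xi>\<^sup>2"])
    fix y :: complex assume "y \<in> ball 0 1"
    then obtain a b where "cmod a \<le> 1" "cmod b \<le> 1" "\<sigma> y = a + b" "\<rho> y = a * b"
      using cl by blast
    then show "\<exists>a b. cmod a \<le> 1 \<and> cmod b \<le> 1 \<and> \<sigma> y / \<xi> = a + b \<and> \<rho> y / \<xi>\<^sup>2 = a * b"
      using \<xi> by (intro exI[of _ "a / \<xi>"] exI[of _ "b / \<xi>"])
        (simp add: norm_divide add_divide_distrib power2_eq_square)
  qed (use \<open>\<xi> \<noteq> 0\<close> z0 z in \<open>auto intro!: holomorphic_intros hol simp: field_simps power2_eq_square\<close>)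
  then show ?thesis
    using \<open>\<xi> \<noteq> 0\<close> by (simp add: field_simps power2_eq_square)
qed

section \<open>Automorphisms preserve common roots\<close>

lemma bounded_linear_scale_vec: "bounded_linear (\<lambda>c. c *s (v :: complex^'n))"
  by (simp add: linear_conv_bounded_linear[symmetric] linear_iff vec_eq_iff algebra_simps)

text \<open>The chain rule along an analytic disc. Complex linearity of the derivative of
  \<open>F\<close> makes the derivative of the composition multiplication by a complex
  number.\<close>

lemma holomorphic_on_comp_sym_pi:
  assumes hol: "holomorphic_map_on F D" and S: "open S" "a holomorphic_on S" "b holomorphic_on S"
    and in_D: "\<And>z. z \<in> S \<Longrightarrow> sym_pi (a z) (b z) \<in> D"
  shows "(\<lambda>z. F (sym_pi (a z) (b z)) $ i) holomorphic_on S"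
proof (rule holomorphic_onI)
  fix z assume z: "z \<in> S"
  obtain f' where f': "(F has_derivative f') (at (sym_pi (a z) (b z)))" "\<And>c v. f' (c *s v) = c *s f' v"
    using hol in_D[OF z] unfolding holomorphic_map_on_def by blast
  obtain a' b' where "(a has_field_derivative a') (at z)" "(b has_field_derivative b') (at z)"
    using S z by (meson holomorphic_on_open)
  then have 1: "((\<lambda>z. a z + b z) has_derivative (*) (a' + b')) (at z)"
    "((\<lambda>z. a z * b z) has_derivative (*) (a' * b z + b' * a z)) (at z)"
    unfolding has_field_derivative_def[symmetric] by (auto intro!: derivative_eq_intros)
  \<comment> \<open>The complex tangent vector of the disc at \<open>z\<close>.\<close>
  define v where "v = (a' + b') *s axis 1 1 + (a' * b z + b' * a z) *s (axis 2 1 :: complex^2)"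
  have eq: "sym_pi x y = (x + y) *s axis 1 1 + (x * y) *s axis 2 1" for x y
    by (simp add: vec_eq_iff forall_2 axis_def)
  have "((\<lambda>z. sym_pi (a z) (b z)) has_derivative
      (\<lambda>t. ((a' + b') * t) *s axis 1 1 + ((a' * b z + b' * a z) * t) *s axis 2 1)) (at z)"
    unfolding eq by (intro has_derivative_add bounded_linear.has_derivative[OF bounded_linear_scale_vec] 1)
  also have "(\<lambda>t. ((a' + b') * t) *s axis 1 1 + ((a' * b z + b' * a z) * t) *s axis 2 1) = (\<lambda>t. t *s v)"
    by (simp add: v_def fun_eq_iff vec_eq_iff algebra_simps)
  finally have "((\<lambda>z. F (sym_pi (a z) (b z))) has_derivative (\<lambda>t. f' (t *s v))) (at z)"
    using f'(1) by (rule has_derivative_compose)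
  then have "((\<lambda>z. F (sym_pi (a z) (b z)) $ i) has_derivative (\<lambda>t. f' (t *s v) $ i)) (at z)"
    by (rule bounded_linear.has_derivative[OF bounded_linear_vec_nth])
  also have "(\<lambda>t. f' (t *s v) $ i) = (*) (f' v $ i)"
    by (simp add: f'(2) fun_eq_iff)
  finally show "(\<lambda>z. F (sym_pi (a z) (b z)) $ i) field_differentiable (at z within S)"
    using field_differentiable_at_within field_differentiable_def has_field_derivative_def by blast
qed

text \<open>The resultant of \<open>t\<^sup>2 - x\<^sub>1 t + x\<^sub>2\<close> and \<open>t\<^sup>2 - y\<^sub>1 t + y\<^sub>2\<close>.\<close>

definition resultant :: "complex^2 \<Rightarrow> complex^2 \<Rightarrow> complex" where
  "resultant x y = (x $ 2 - y $ 2)\<^sup>2 - x $ 1 * (x $ 1 - y $ 1) * (x $ 2 - y $ 2)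
     + x $ 2 * (x $ 1 - y $ 1)\<^sup>2"

lemma resultant_sym_pi: "resultant (sym_pi a b) (sym_pi c d) = (a - c) * (a - d) * (b - c) * (b - d)"
  by (simp add: resultant_def power2_eq_square algebra_simps)

text \<open>The assumptions are symmetric in \<open>F\<close> and \<open>G\<close>, so every fact is
  also available for the inverse map through the sublocale \<open>inverse\<close>.\<close>

locale G2_biholomorphism =
  fixes F G :: "complex^2 \<Rightarrow> complex^2"
  assumes F_in: "x \<in> G2 \<Longrightarrow> F x \<in> G2" and G_in: "x \<in> G2 \<Longrightarrow> G x \<in> G2"
    and GF: "x \<in> G2 \<Longrightarrow> G (F x) = x" and FG: "x \<in> G2 \<Longrightarrow> F (G x) = x"
    and hol_F: "holomorphic_map_on F G2" and hol_G: "holomorphic_map_on G G2"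
begin


sublocale inverse: G2_biholomorphism G F
  by unfold_locales (fact G_in F_in FG GF hol_G hol_F)+

text \<open>Properness of \<open>F\<close>: were the limit in \<open>G2\<close>, continuity of
  \<open>G\<close> would make the points with roots 0 and \<open>w n\<close> converge inside
  \<open>G2\<close>, to a point with one root 0 and the other of modulus 1.\<close>

lemma limit_not_in_G2:
  assumes w: "\<And>n. w n \<in> unit_disc" "(\<lambda>n. cmod (w n)) \<longlonglongrightarrow> 1"
    and lim: "(\<lambda>n. F (sym_pi 0 (w n))) \<longlonglongrightarrow> x"
  shows "x \<notin> G2"
proof
  assume x: "x \<in> G2"
  then have "isCont G x"
    using hol_G by (auto simp: holomorphic_map_on_def intro: has_derivative_continuous)
  then have "(\<lambda>n. G (F (sym_pi 0 (w n)))) \<longlonglongrightarrow> G x"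
    using lim by (rule isCont_tendsto_compose)
  moreover have "0 \<in> unit_disc"
    by (simp add: unit_disc_def)
  ultimately have *: "(\<lambda>n. sym_pi 0 (w n)) \<longlonglongrightarrow> G x"
    using w by (simp add: GF sym_pi_in_G2)
  have "w \<longlonglongrightarrow> G x $ 1"
    using tendsto_vec_nth[OF *, of 1] by simp
  then have "cmod (G x $ 1) = 1"
    using tendsto_norm w(2) LIMSEQ_unique by blast
  moreover have "G x $ 2 = 0"
    using tendsto_vec_nth[OF *, of 2] by (simp add: LIMSEQ_const_iff)
  moreover obtain a b where "G x = sym_pi a b" "a \<in> unit_disc" "b \<in> unit_disc"
    using G_in[OF x] by (auto simp: G2_def)
  ultimately show False
    by (auto simp: unit_disc_def)
qed

lemma hol_coord: "w \<in> unit_disc \<Longrightarrow> (\<lambda>z. F (sym_pi z w) $ i) holomorphic_on ball 0 1"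
  by (rule holomorphic_on_comp_sym_pi[OF hol_F])
    (auto intro!: sym_pi_in_G2 holomorphic_intros simp: unit_disc_eq_ball)

lemma hol_coord': "z \<in> unit_disc \<Longrightarrow> (\<lambda>w. F (sym_pi z w) $ i) holomorphic_on ball 0 1"
  using hol_coord[of z i] by (simp add: sym_pi_commute)

lemma coord_bound:
  assumes "x \<in> G2"
  shows "cmod (x $ i) \<le> 2"
proof -
  obtain a b where "x = sym_pi a b" "cmod a < 1" "cmod b < 1"
    using assms by (auto simp: G2_def unit_disc_def)
  moreover from this have "cmod (a + b) \<le> 2" "cmod (a * b) \<le> 2"
    using norm_triangle_ineq[of a b] mult_le_one[of "cmod a" "cmod b"] by (auto simp: norm_mult)
  ultimately show ?thesis
    using exhaust_2[of i] by auto
qed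

text \<open>Montel's theorem is applied to the first coordinates, then to the second coordinates
  along the subsequence found.\<close>

lemma convergent_subsequence:
  assumes w: "\<And>n. w n \<in> unit_disc"
  obtains r \<phi> where "strict_mono (r :: nat \<Rightarrow> nat)"
    "\<And>i. (\<lambda>z. \<phi> z $ i) holomorphic_on ball 0 1"
    "\<And>z. z \<in> ball 0 1 \<Longrightarrow> (\<lambda>n. F (sym_pi z (w (r n)))) \<longlonglongrightarrow> \<phi> z"
proof -
  define \<F> where "\<F> i = {h. h holomorphic_on ball 0 1 \<and> (\<forall>z\<in>ball 0 1. cmod (h z) \<le> 2)}" for i :: 2
  have mem: "(\<lambda>z. F (sym_pi z (w n)) $ i) \<in> \<F> i" for n i
    using w by (auto simp: \<F>_def intro!: hol_coord coord_bound F_in sym_pi_in_G2 simp: unit_disc_def)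
  have bdd: "\<exists>B. \<forall>h\<in>\<F> i. \<forall>z\<in>K. cmod (h z) \<le> B" if "K \<subseteq> ball 0 1" for K i
    using that by (auto simp: \<F>_def)
  obtain \<sigma> r where 1: "\<sigma> holomorphic_on ball 0 1" "strict_mono (r :: nat \<Rightarrow> nat)"
    "\<And>z. z \<in> ball 0 1 \<Longrightarrow> (\<lambda>n. F (sym_pi z (w (r n))) $ 1) \<longlonglongrightarrow> \<sigma> z"
    by (rule Montel[of "ball 0 1" "\<F> 1" "\<lambda>n z. F (sym_pi z (w n)) $ 1"]) (use mem bdd in \<open>auto simp: \<F>_def\<close>)
  obtain \<rho> q where 2: "\<rho> holomorphic_on ball 0 1" "strict_mono (q :: nat \<Rightarrow> nat)"
    "\<And>z. z \<in> ball 0 1 \<Longrightarrow> (\<lambda>n. F (sym_pi z (w (r (q n)))) $ 2) \<longlonglongrightarrow> \<rho> z"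
    by (rule Montel[of "ball 0 1" "\<F> 2" "\<lambda>n z. F (sym_pi z (w (r n))) $ 2"]) (use mem bdd in \<open>auto simp: \<F>_def\<close>)
  show ?thesis
  proof (rule that[of "r \<circ> q" "\<lambda>z. vector [\<sigma> z, \<rho> z]"])
    show "strict_mono (r \<circ> q)"
      using 1 2 by (simp add: strict_mono_o)
    show "(\<lambda>z. (vector [\<sigma> z, \<rho> z] :: complex^2) $ i) holomorphic_on ball 0 1" for i
      using exhaust_2[of i] 1 2 by auto
    fix z :: complex assume z: "z \<in> ball 0 1"
    have "(\<lambda>n. F (sym_pi z (w (r (q n)))) $ 1) \<longlonglongrightarrow> \<sigma> z"
      using LIMSEQ_subseq_LIMSEQ[OF 1(3)[OF z] 2(2)] by (simp add: o_def)
    then have "(\<lambda>n. F (sym_pi z (w ((r \<circ> q) n))) $ i) \<longlonglongrightarrow> vector [\<sigma> z, \<rho> z] $ i" for i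
      using 2(3)[OF z] exhaust_2[of i] by auto
    then show "(\<lambda>n. F (sym_pi z (w ((r \<circ> q) n)))) \<longlonglongrightarrow> vector [\<sigma> z, \<rho> z]"
      by (rule vec_tendstoI)
  qed
qed

lemma resultant_eq_0:
  assumes z: "z \<in> unit_disc" "z' \<in> unit_disc" and w0: "w0 \<in> unit_disc"
  shows "resultant (F (sym_pi z w0)) (F (sym_pi z' w0)) = 0"
proof (rule holomorphic_on_ball_vanishing_boundary[of "\<lambda>w. resultant (F (sym_pi z w)) (F (sym_pi z' w))"])
  show "(\<lambda>w. resultant (F (sym_pi z w)) (F (sym_pi z' w))) holomorphic_on ball 0 1"
    unfolding resultant_def by (intro holomorphic_intros hol_coord' z)
next
  fix e :: real assume "e > 0"
  show "\<exists>r<1. \<forall>w. r < cmod w \<and> cmod w < 1 \<longrightarrow> cmod (resultant (F (sym_pi z w)) (F (sym_pi z' w))) < e"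
  \<comment> \<open>Failure of the uniform estimate yields a sequence \<open>w n\<close> approaching
    the circle along which the resultant stays at least \<open>e\<close>; a limit disc
    \<open>\<phi>\<close> refutes this.\<close>
  proof (rule ccontr)
    assume "\<not> ?thesis"
    then have "\<exists>w. r < cmod w \<and> cmod w < 1 \<and> cmod (resultant (F (sym_pi z w)) (F (sym_pi z' w))) \<ge> e" if "r < 1" for r
      using that by (meson not_less)
    then have "\<exists>w. 1 - 1 / real (Suc n) < cmod w \<and> cmod w < 1 \<and>
        cmod (resultant (F (sym_pi z w)) (F (sym_pi z' w))) \<ge> e" for n
      by simp
    then obtain w where w: "\<And>n. 1 - 1 / real (Suc n) < cmod (w n)" "\<And>n. cmod (w n) < 1"
      "\<And>n. cmod (resultant (F (sym_pi z (w n))) (F (sym_pi z' (w n)))) \<ge> e"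
      by metis
    have w1: "(\<lambda>n. cmod (w n)) \<longlonglongrightarrow> 1"
    proof (rule tendsto_sandwich)
      show "(\<lambda>n. 1 - 1 / real (Suc n)) \<longlonglongrightarrow> 1"
        using tendsto_diff[OF tendsto_const LIMSEQ_inverse_real_of_nat, of 1] by (simp add: inverse_eq_divide)
    qed (use w in \<open>auto intro!: always_eventually less_imp_le\<close>)
    have w_in: "w n \<in> unit_disc" for n
      using w(2) by (simp add: unit_disc_def)
    obtain r \<phi> where r: "strict_mono (r :: nat \<Rightarrow> nat)" and hol: "\<And>i. (\<lambda>z. \<phi> z $ i) holomorphic_on ball 0 1"
      and lim: "\<And>z. z \<in> ball 0 1 \<Longrightarrow> (\<lambda>n. F (sym_pi z (w (r n)))) \<longlonglongrightarrow> \<phi> z"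
      by (rule convergent_subsequence[of w, OF w_in]) blast
    have closure: "\<exists>a b. cmod a \<le> 1 \<and> cmod b \<le> 1 \<and> \<phi> y = sym_pi a b" if "y \<in> ball 0 1" for y
    proof -
      have "F (sym_pi y (w (r n))) \<in> (\<lambda>(a, b). sym_pi a b) ` (cball 0 1 \<times> cball 0 1)" for n
      proof -
        have "F (sym_pi y (w (r n))) \<in> G2"
          using that w_in by (auto intro!: F_in sym_pi_in_G2 simp: unit_disc_eq_ball)
        then show ?thesis
          by (force simp: G2_def unit_disc_def)
      qed
      then have "\<phi> y \<in> (\<lambda>(a, b). sym_pi a b) ` (cball 0 1 \<times> cball 0 1)"
        by (rule closed_sequentially[OF closed_sym_pi_cball _ lim[OF that]])
      then show ?thesis
        by clarsimp blast
    qed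
    have "\<phi> 0 \<notin> G2"
      by (rule limit_not_in_G2[of "w \<circ> r"])
        (use w_in lim[of 0] LIMSEQ_subseq_LIMSEQ[OF w1 r] in \<open>auto simp: o_def\<close>)
    moreover obtain a b where "cmod a \<le> 1" "cmod b \<le> 1" "\<phi> 0 = sym_pi a b"
      using closure[of 0] by auto
    \<comment> \<open>Both roots of \<open>\<phi> 0\<close> lie in the closed disc and not both in
      the open disc, so one of them is unimodular.\<close>
    ultimately obtain \<xi> c where \<xi>: "cmod \<xi> = 1" "\<phi> 0 = sym_pi \<xi> c"
      by (metis sym_pi_commute sym_pi_in_G2 mem_Collect_eq order_le_less unit_disc_def)
    \<comment> \<open>The root \<open>\<xi>\<close> found at the centre persists on the whole disc,
      so it is shared by \<open>\<phi> z\<close> and \<open>\<phi> z'\<close>, whose resultant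
      therefore vanishes.\<close>
    have disc: "\<phi> y $ 2 = \<xi> * (\<phi> y $ 1 - \<xi>)" if "y \<in> ball 0 1" for y
    proof (rule boundary_disc[where \<sigma> = "\<lambda>z. \<phi> z $ 1" and \<rho> = "\<lambda>z. \<phi> z $ 2" and ?z0.0 = 0])
      show "\<exists>a b. cmod a \<le> 1 \<and> cmod b \<le> 1 \<and> \<phi> z $ 1 = a + b \<and> \<phi> z $ 2 = a * b" if "z \<in> ball 0 1" for z
        using closure[OF that] by (metis sym_pi_nth)
    qed (use \<xi> hol that in auto)
    have "(\<lambda>n. resultant (F (sym_pi z (w (r n)))) (F (sym_pi z' (w (r n))))) \<longlonglongrightarrow> resultant (\<phi> z) (\<phi> z')"
      unfolding resultant_def using z by (intro tendsto_intros lim) (auto simp: unit_disc_eq_ball)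
    moreover have "resultant (\<phi> z) (\<phi> z') = 0"
      using z unfolding resultant_def unit_disc_eq_ball by (simp add: disc power2_eq_square algebra_simps)
    ultimately have "(\<lambda>n. resultant (F (sym_pi z (w (r n)))) (F (sym_pi z' (w (r n))))) \<longlonglongrightarrow> 0"
      by simp
    then have "e \<le> cmod 0"
      using w(3) by (intro Lim_norm_lbound[where net = sequentially]) auto
    then show False
      using \<open>e > 0\<close> by simp
  qed
qed (use w0 in \<open>simp add: unit_disc_eq_ball\<close>)

lemma images_share_root:
  assumes "z \<in> unit_disc" "z' \<in> unit_disc" "w \<in> unit_disc"
  shows "root_set (F (sym_pi z w)) \<inter> root_set (F (sym_pi z' w)) \<noteq> {}"
proof -
  obtain a b c d where "F (sym_pi z w) = sym_pi a b" "F (sym_pi z' w) = sym_pi c d"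
    using exists_sym_pi by metis
  with resultant_eq_0[OF assms] show ?thesis
    by (auto simp: resultant_sym_pi)
qed

end

section \<open>Reconstruction from common roots\<close>

text \<open>Without a common element, some \<open>B\<close> misses \<open>a\<close> and some
  \<open>D\<close> misses \<open>b\<close>, for a fixed member \<open>{a, b}\<close>. A member
  containing \<open>a\<close> must take its other element from \<open>B\<close>, one containing
  \<open>b\<close> from \<open>D\<close>; this leaves only finitely many members.\<close>

lemma infinite_intersecting_pairs_common_element:
  assumes inf: "infinite C" and pair: "\<And>A. A \<in> C \<Longrightarrow> \<exists>a b. A = {a, b}"
    and int: "\<And>A B. A \<in> C \<Longrightarrow> B \<in> C \<Longrightarrow> A \<inter> B \<noteq> {}"
  shows "\<exists>v. \<forall>A\<in>C. v \<in> A"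
proof (rule ccontr)
  assume none: "\<not> ?thesis"
  obtain A where "A \<in> C"
    using inf by (metis all_not_in_conv finite.emptyI)
  then obtain a b where A: "{a, b} \<in> C"
    using pair by metis
  obtain B D where B: "B \<in> C" "a \<notin> B" and D: "D \<in> C" "b \<notin> D"
    using none by metis
  have "b \<in> B" "a \<in> D"
    using int[OF A B(1)] int[OF A D(1)] B D by auto
  have "X \<subseteq> {a, b} \<union> B \<union> D" if "X \<in> C" for X
  proof -
    obtain x y where "X = {x, y}"
      using pair \<open>X \<in> C\<close> by metis
    then show ?thesis
      using int[OF that A] int[OF that B(1)] int[OF that D(1)] B D \<open>b \<in> B\<close> \<open>a \<in> D\<close> by auto
  qed
  then have "C \<subseteq> Pow ({a, b} \<union> B \<union> D)"
    by blast
  moreover have "finite ({a, b} \<union> B \<union> D)"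
    using pair[OF B(1)] pair[OF D(1)] by auto
  ultimately show False
    using inf finite_subset by blast
qed

lemma infinite_unit_disc: "infinite unit_disc"
  unfolding unit_disc_eq_ball using uncountable_ball[of 1 "0::complex"] countable_finite by auto

lemma H_extensional: "H h \<in> extensional G2"
  by (simp add: H_def)

context G2_biholomorphism
begin

lemma inj: "x \<in> G2 \<Longrightarrow> y \<in> G2 \<Longrightarrow> F x = F y \<Longrightarrow> x = y"
  by (metis GF)

text \<open>With \<open>w\<close> fixed, injectivity of \<open>F\<close> makes the root sets
  pairwise distinct, hence an infinite family of intersecting pairs.\<close>

lemma ex_common_root:
  assumes w: "w \<in> unit_disc"
  shows "\<exists>v. \<forall>z\<in>unit_disc. v \<in> root_set (F (sym_pi z w))"
proof -
  have "inj_on (\<lambda>z. root_set (F (sym_pi z w))) unit_disc"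
  proof (rule inj_onI)
    fix z z' assume "z \<in> unit_disc" "z' \<in> unit_disc"
      "root_set (F (sym_pi z w)) = root_set (F (sym_pi z' w))"
    then have "sym_pi z w = sym_pi z' w"
      using w by (metis inj root_set_inj F_in sym_pi_in_G2)
    then show "z = z'"
      by (auto simp: sym_pi_eq_iff)
  qed
  then have "infinite ((\<lambda>z. root_set (F (sym_pi z w))) ` unit_disc)"
    using infinite_unit_disc by (simp add: finite_image_iff)
  moreover have "\<exists>a b. root_set x = {a, b}" for x
    using exists_sym_pi[of x] by (metis root_set_sym_pi)
  ultimately have "\<exists>v. \<forall>A\<in>(\<lambda>z. root_set (F (sym_pi z w))) ` unit_disc. v \<in> A"
    by (intro infinite_intersecting_pairs_common_element) (use images_share_root w in auto)
  then show ?thesis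
    by blast
qed

text \<open>The map \<open>h\<close> with \<open>F = H h\<close>. Its values outside the disc are
  arbitrary, hence the later \<open>restrict\<close>.\<close>

definition common_root :: "complex \<Rightarrow> complex" where
  "common_root w = (SOME v. \<forall>z\<in>unit_disc. v \<in> root_set (F (sym_pi z w)))"

lemma common_root:
  assumes "z \<in> unit_disc" "w \<in> unit_disc"
  shows "common_root w \<in> root_set (F (sym_pi z w))"
  using someI_ex[OF ex_common_root[OF assms(2)]] assms(1) unfolding common_root_def by blast

lemma common_root_in_disc: "w \<in> unit_disc \<Longrightarrow> common_root w \<in> unit_disc"
  using common_root[of w w] root_set_subset F_in sym_pi_in_G2 by blast

end

text \<open>The context is left and entered again so that the facts just proved become available for
  the sublocale \<open>inverse\<close>.\<close>

context G2_biholomorphism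
begin

text \<open>The diagonal point \<open>sym_pi w w\<close> has \<open>w\<close> as its only root. Its
  image has \<open>common_root w\<close> as a root, so mapping back by \<open>G\<close> can only
  give \<open>w\<close>.\<close>

lemma inverse_common_root:
  assumes "w \<in> unit_disc"
  shows "inverse.common_root (common_root w) = w"
proof -
  have "F (sym_pi w w) \<in> G2"
    using assms by (intro F_in sym_pi_in_G2)
  then obtain b where b: "b \<in> unit_disc" "F (sym_pi w w) = sym_pi (common_root w) b"
    using sym_pi_of_root common_root[OF assms assms] by blast
  have "inverse.common_root (common_root w) \<in> root_set (G (sym_pi b (common_root w)))"
    using b assms by (intro inverse.common_root common_root_in_disc)
  also have "G (sym_pi b (common_root w)) = sym_pi w w"
    using b GF[of "sym_pi w w"] sym_pi_in_G2[OF assms assms] by (simp add: sym_pi_commute)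
  finally show ?thesis
    by simp
qed

text \<open>Having a left inverse, \<open>common_root\<close> is injective on the disc; its two
  distinct values exhaust the roots of the image.\<close>

lemma F_sym_pi_distinct:
  assumes "z \<in> unit_disc" "w \<in> unit_disc" "z \<noteq> w"
  shows "F (sym_pi z w) = sym_pi (common_root z) (common_root w)"
proof -
  have "common_root z \<noteq> common_root w"
    using inverse_common_root assms by metis
  moreover have "common_root w \<in> root_set (F (sym_pi z w))" "common_root z \<in> root_set (F (sym_pi z w))"
    using common_root assms sym_pi_commute by metis+
  ultimately show ?thesis
    using exists_sym_pi[of "F (sym_pi z w)"] by (auto simp: sym_pi_commute)
qed

end

context G2_biholomorphism
begin

text \<open>On the diagonal, the second root \<open>b\<close> of the image of
  \<open>sym_pi w w\<close> is \<open>common_root u\<close> for some \<open>u\<close>. If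
  \<open>u\<close> differed from \<open>w\<close>, the off-diagonal case would give
  \<open>sym_pi u w\<close> the same image, against injectivity.\<close>

lemma F_sym_pi:
  assumes "z \<in> unit_disc" "w \<in> unit_disc"
  shows "F (sym_pi z w) = sym_pi (common_root z) (common_root w)"
proof (cases "z = w")
  case True
  have F: "F (sym_pi w w) \<in> G2"
    using assms by (intro F_in sym_pi_in_G2)
  then obtain b where b: "b \<in> unit_disc" "F (sym_pi w w) = sym_pi (common_root w) b"
    using sym_pi_of_root common_root[OF assms(2) assms(2)] by blast
  define u where "u = inverse.common_root b"
  have u: "u \<in> unit_disc" "common_root u = b"
    using b inverse.common_root_in_disc inverse.inverse_common_root by (auto simp: u_def)
  have "u = w"
  proof (rule ccontr)
    assume "u \<noteq> w"
    then have "F (sym_pi u w) = F (sym_pi w w)"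
      using F_sym_pi_distinct[OF u(1) assms(2)] b u by (simp add: sym_pi_commute)
    then have "sym_pi u w = sym_pi w w"
      using u assms by (metis inj sym_pi_in_G2)
    then show False
      using \<open>u \<noteq> w\<close> by (auto simp: sym_pi_eq_iff)
  qed
  then show ?thesis
    using b u True by simp
qed (use F_sym_pi_distinct assms in blast)

text \<open>On the diagonal the first coordinate of \<open>F\<close> is twice
  \<open>common_root\<close>.\<close>

lemma common_root_holomorphic: "common_root holomorphic_on unit_disc"
proof -
  have "(\<lambda>z. F (sym_pi z z) $ 1 / 2) holomorphic_on unit_disc"
    unfolding unit_disc_eq_ball
    by (intro holomorphic_intros holomorphic_on_comp_sym_pi[OF hol_F])
      (auto simp: unit_disc_eq_ball intro: sym_pi_in_G2)
  then show ?thesis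
    by (rule holomorphic_transform) (simp add: F_sym_pi)
qed

end

context G2_biholomorphism
begin

lemma restrict_common_root_Aut1: "restrict common_root unit_disc \<in> Aut1 unit_disc"
proof -
  have bij: "bij_betw (restrict common_root unit_disc) unit_disc unit_disc"
    by (rule bij_betwI[where g = inverse.common_root])
      (auto simp: common_root_in_disc inverse.common_root_in_disc inverse_common_root inverse.inverse_common_root)
  have "inv_into unit_disc (restrict common_root unit_disc) y = inverse.common_root y" if "y \<in> unit_disc" for y
    by (rule inv_into_f_eq)
      (use bij that in \<open>auto simp: bij_betw_def inverse.common_root_in_disc inverse.inverse_common_root\<close>)
  then have "inv_into unit_disc (restrict common_root unit_disc) holomorphic_on unit_disc"
    using inverse.common_root_holomorphic holomorphic_transform by metis
  moreover have "restrict common_root unit_disc holomorphic_on unit_disc"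
    using common_root_holomorphic by (rule holomorphic_transform) simp
  ultimately show ?thesis
    using bij by (simp add: Aut1_def)
qed

lemma F_eq_H: "x \<in> G2 \<Longrightarrow> F x = H (restrict common_root unit_disc) x"
  by (auto simp: G2_def F_sym_pi H_sym_pi)

end

section \<open>Maps induced by disc automorphisms\<close>

text \<open>With \<open>a\<close> the zero of \<open>f\<close>, a Moebius function \<open>M\<close>
  moving \<open>a\<close> to 0 and its inverse \<open>N\<close>, the maps \<open>f \<circ> N\<close>
  and \<open>M \<circ> g\<close> are mutually inverse and fix 0. The Schwarz lemma bounds both,
  which forces equality and makes \<open>f \<circ> N\<close> linear.\<close>

lemma disc_automorphism_Moebius:
  assumes hol: "f holomorphic_on unit_disc" "g holomorphic_on unit_disc"
    and into: "f \<in> unit_disc \<rightarrow> unit_disc" "g \<in> unit_disc \<rightarrow> unit_disc"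
    and gf: "\<And>z. z \<in> unit_disc \<Longrightarrow> g (f z) = z" and fg: "\<And>z. z \<in> unit_disc \<Longrightarrow> f (g z) = z"
  obtains \<alpha> a where "cmod a < 1" "\<And>z. z \<in> unit_disc \<Longrightarrow> f z = \<alpha> * (z - a) / (1 - cnj a * z)"
proof -
  define a where "a = g 0"
  have 0: "0 \<in> unit_disc"
    by (simp add: unit_disc_def)
  have a: "cmod a < 1" "f a = 0"
    using into(2) fg[OF 0] 0 by (auto simp: a_def unit_disc_def)
  define M N where "M = Moebius_function 0 a" and "N = Moebius_function 0 (- a)"
  have MN: "M holomorphic_on unit_disc" "N holomorphic_on unit_disc"
    "M \<in> unit_disc \<rightarrow> unit_disc" "N \<in> unit_disc \<rightarrow> unit_disc"
    unfolding M_def N_def using a Moebius_function_norm_lt_1 Moebius_function_holomorphic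
    by (auto simp: unit_disc_def ball_def)
  have inv: "M (N z) = z" "N (M z) = z" if "z \<in> unit_disc" for z
    unfolding M_def N_def using a that by (auto simp: unit_disc_def intro!: Moebius_function_compose)
  have "M a = 0" "N 0 = a"
    by (simp_all add: M_def N_def Moebius_function_eq_zero Moebius_function_of_zero)
  have \<phi>: "cmod (f (N z)) \<le> cmod z"
    "\<exists>z. cmod z < 1 \<and> z \<noteq> 0 \<and> cmod (f (N z)) = cmod z \<Longrightarrow> \<exists>\<alpha>. \<forall>z. cmod z < 1 \<longrightarrow> f (N z) = \<alpha> * z"
    if "z \<in> unit_disc" for z
  proof -
    have "(f \<circ> N) holomorphic_on ball 0 1"
      using holomorphic_on_compose_gen[OF MN(2) hol(1)] MN by (auto simp: unit_disc_eq_ball)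
    moreover have "(f \<circ> N) 0 = 0"
      using a \<open>N 0 = a\<close> by simp
    moreover have "cmod ((f \<circ> N) z) < 1" if "cmod z < 1" for z
      using into MN that by (auto simp: unit_disc_def Pi_iff)
    ultimately show "cmod (f (N z)) \<le> cmod z"
      "\<exists>z. cmod z < 1 \<and> z \<noteq> 0 \<and> cmod (f (N z)) = cmod z \<Longrightarrow> \<exists>\<alpha>. \<forall>z. cmod z < 1 \<longrightarrow> f (N z) = \<alpha> * z"
      using Schwarz_Lemma[of "f \<circ> N" z] that unfolding unit_disc_def o_def by auto
  qed
  have \<psi>: "cmod (M (g z)) \<le> cmod z" if "z \<in> unit_disc" for z
  proof -
    have "(M \<circ> g) holomorphic_on ball 0 1"
      using holomorphic_on_compose_gen[OF hol(2) MN(1)] into by (auto simp: unit_disc_eq_ball)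
    moreover have "(M \<circ> g) 0 = 0"
      using \<open>M a = 0\<close> by (simp add: a_def)
    moreover have "cmod ((M \<circ> g) z) < 1" if "cmod z < 1" for z
      using into MN that by (auto simp: unit_disc_def Pi_iff)
    ultimately show ?thesis
      using Schwarz_Lemma(1)[of "M \<circ> g" z] that unfolding unit_disc_def o_def by auto
  qed
  \<comment> \<open>A sample nonzero point at which equality in the Schwarz lemma is
    checked.\<close>
  have half: "1 / 2 \<in> unit_disc"
    by (simp add: unit_disc_def)
  then have "M (g (f (N (1 / 2)))) = 1 / 2" "f (N (1 / 2)) \<in> unit_disc"
    using gf inv MN into by (auto simp: Pi_iff)
  then have "cmod (f (N (1 / 2))) = cmod (1 / 2)"
    using \<phi>(1)[OF half] \<psi>[of "f (N (1 / 2))"] by (metis order_antisym)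
  moreover have "cmod (1 / 2) < 1" "(1 / 2 :: complex) \<noteq> 0"
    by simp_all
  ultimately obtain \<alpha> where \<alpha>: "\<And>z. cmod z < 1 \<Longrightarrow> f (N z) = \<alpha> * z"
    using \<phi>(2)[OF half] by metis
  have "f z = \<alpha> * (z - a) / (1 - cnj a * z)" if "z \<in> unit_disc" for z
  proof -
    have "cmod (M z) < 1"
      using MN that by (auto simp: unit_disc_def)
    then have "f z = \<alpha> * M z"
      using \<alpha>[of "M z"] inv[OF that] by simp
    then show ?thesis
      by (simp add: M_def Moebius_function_simple)
  qed
  with a show ?thesis
    by (intro that)
qed

section \<open>Holomorphy of quotients of affine functions in two variables\<close>

lemma has_derivative_affine_quotient:
  fixes p :: complex and x :: "complex^2"
  assumes "p' + q' * x $ 1 + r' * x $ 2 \<noteq> 0"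
  shows "\<exists>f'. ((\<lambda>x. (p + q * x $ 1 + r * x $ 2) / (p' + q' * x $ 1 + r' * x $ 2)) has_derivative f') (at x)
    \<and> (\<forall>c v. f' (c *s v) = c * f' v)"
proof -
  have aff: "((\<lambda>x :: complex^2. p + q * x $ 1 + r * x $ 2) has_derivative (\<lambda>v. q * v $ 1 + r * v $ 2)) (at x)"
    for p q r
    by (auto intro!: derivative_eq_intros bounded_linear.has_derivative[OF bounded_linear_vec_nth])
  show ?thesis
    by (intro exI conjI, rule has_derivative_divide'[OF aff aff assms])
      (simp add: field_simps assms)
qed

lemma holomorphic_map_on_vector2:
  assumes "\<And>x. x \<in> D \<Longrightarrow> \<exists>f'. (f has_derivative f') (at x) \<and> (\<forall>c v. f' (c *s v) = c * f' v)"
    and "\<And>x. x \<in> D \<Longrightarrow> \<exists>g'. (g has_derivative g') (at x) \<and> (\<forall>c v. g' (c *s v) = c * g' v)"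
  shows "holomorphic_map_on (\<lambda>x. vector [f x, g x] :: complex^2) D"
  unfolding holomorphic_map_on_def
proof
  fix x assume "x \<in> D"
  then obtain f' g' where f': "(f has_derivative f') (at x)" "\<And>c v. f' (c *s v) = c * f' v"
    and g': "(g has_derivative g') (at x)" "\<And>c v. g' (c *s v) = c * g' v"
    using assms by meson
  have eq: "(vector [y, z] :: complex^2) = y *s axis 1 1 + z *s axis 2 1" for y z
    by (simp add: vec_eq_iff forall_2 axis_def)
  have "((\<lambda>x. vector [f x, g x] :: complex^2) has_derivative (\<lambda>v. vector [f' v, g' v])) (at x)"
    unfolding eq by (intro has_derivative_add bounded_linear.has_derivative[OF bounded_linear_scale_vec] f' g')
  moreover have "vector [f' (c *s v), g' (c *s v)] = c *s (vector [f' v, g' v] :: complex^2)" for c v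
    by (simp add: f' g' vec_eq_iff forall_2)
  ultimately show "\<exists>h'. ((\<lambda>x. vector [f x, g x] :: complex^2) has_derivative h') (at x) \<and>
      (\<forall>c v. h' (c *s v) = c *s h' v)"
    by blast
qed

lemma holomorphic_map_on_transform:
  assumes "holomorphic_map_on f D" "open D" "\<And>x. x \<in> D \<Longrightarrow> f x = g x"
  shows "holomorphic_map_on g D"
  using assms unfolding holomorphic_map_on_def by (meson has_derivative_transform_within_open)

text \<open>The Moebius form of \<open>f\<close> gives the coordinates of \<open>H f\<close> as
  quotients of affine functions of the coordinates of the point, also where the two roots coincide
  and do not depend smoothly on it.\<close>

lemma H_holomorphic:
  assumes "f holomorphic_on unit_disc" "g holomorphic_on unit_disc"
    and "f \<in> unit_disc \<rightarrow> unit_disc" "g \<in> unit_disc \<rightarrow> unit_disc"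
    and "\<And>z. z \<in> unit_disc \<Longrightarrow> g (f z) = z" "\<And>z. z \<in> unit_disc \<Longrightarrow> f (g z) = z"
  shows "holomorphic_map_on (H f) G2"
proof -
  obtain \<alpha> a where a: "cmod a < 1" and f: "\<And>z. z \<in> unit_disc \<Longrightarrow> f z = \<alpha> * (z - a) / (1 - cnj a * z)"
    using disc_automorphism_Moebius[OF assms] by blast
  \<comment> \<open>The sum and the product of \<open>f l\<close> and \<open>f m\<close> over the
    common denominator \<open>(1 - cnj a * l) * (1 - cnj a * m)\<close>, expanded in
    \<open>l + m\<close> and \<open>l * m\<close>.\<close>
  define d where "d x = 1 + - cnj a * x $ 1 + (cnj a)\<^sup>2 * x $ 2" for x :: "complex^2"
  define s where "s x = (- 2 * \<alpha> * a + \<alpha> * (1 + a * cnj a) * x $ 1 + - 2 * \<alpha> * cnj a * x $ 2) / d x"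
    for x :: "complex^2"
  define p where "p x = (\<alpha>\<^sup>2 * a\<^sup>2 + - \<alpha>\<^sup>2 * a * x $ 1 + \<alpha>\<^sup>2 * x $ 2) / d x" for x :: "complex^2"
  have d_eq: "d (sym_pi l m) = (1 - cnj a * l) * (1 - cnj a * m)" for l m
    by (simp add: d_def power2_eq_square algebra_simps)
  have ne: "1 - cnj a * l \<noteq> 0" if "l \<in> unit_disc" for l
  proof
    assume "1 - cnj a * l = 0"
    then have "cmod a * cmod l = 1"
      by (metis complex_mod_cnj eq_iff_diff_eq_0 norm_mult norm_one)
    then show False
      using a that norm_mult_less[of a 1 l 1] by (simp add: unit_disc_def norm_mult)
  qed
  have d_ne: "d x \<noteq> 0" if "x \<in> G2" for x
    using that ne by (auto simp: G2_def d_eq)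
  have quot: "\<exists>f'. ((\<lambda>x. (u + v * x $ 1 + w * x $ 2) / d x) has_derivative f') (at x)
      \<and> (\<forall>c y. f' (c *s y) = c * f' y)" if "x \<in> G2" for u v w x
    using has_derivative_affine_quotient[OF d_ne[OF that, unfolded d_def], of u v w] unfolding d_def .
  have "holomorphic_map_on (\<lambda>x. vector [s x, p x] :: complex^2) G2"
    unfolding s_def p_def by (intro holomorphic_map_on_vector2 quot)
  then show ?thesis
  proof (rule holomorphic_map_on_transform[OF _ open_G2])
    fix x assume "x \<in> G2"
    then obtain l m where x: "x = sym_pi l m" and lm: "l \<in> unit_disc" "m \<in> unit_disc"
      by (auto simp: G2_def)
    have "s x = f l + f m"
      using ne[OF lm(1)] ne[OF lm(2)] unfolding s_def x d_eq f[OF lm(1)] f[OF lm(2)]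
      by (simp add: add_frac_eq) (simp add: algebra_simps)
    moreover have "p x = f l * f m"
      unfolding p_def x d_eq f[OF lm(1)] f[OF lm(2)]
      by (simp add: power2_eq_square algebra_simps)
    ultimately show "vector [s x, p x] = H f x"
      using lm by (simp add: x H_sym_pi) (simp add: sym_pi_def)
  qed
qed

text \<open>For \<open>g\<close> the inverse of \<open>h\<close>, the map \<open>H g\<close> inverts
  \<open>H h\<close> on \<open>G2\<close>, so holomorphy in both directions comes from
  \<open>H_holomorphic\<close>.\<close>

lemma H_in_Aut:
  assumes "h \<in> Aut1 unit_disc"
  shows "H h \<in> Aut G2"
proof -
  define g where "g = inv_into unit_disc h"
  have hol: "h holomorphic_on unit_disc" "g holomorphic_on unit_disc" and bij: "bij_betw h unit_disc unit_disc"
    using assms by (auto simp: Aut1_def g_def)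
  have into: "h \<in> unit_disc \<rightarrow> unit_disc" "g \<in> unit_disc \<rightarrow> unit_disc"
    using bij bij_betw_inv_into[OF bij] by (auto simp: bij_betw_def g_def)
  have inv: "g (h z) = z" "h (g z) = z" if "z \<in> unit_disc" for z
    using bij that by (auto simp: g_def bij_betw_inv_into_left bij_betw_inv_into_right)
  have Hg: "H g x \<in> G2" "H h x \<in> G2" "H g (H h x) = x" "H h (H g x) = x" if "x \<in> G2" for x
    using that into inv by (auto simp: G2_def H_sym_pi Pi_iff) blast+
  have bijH: "bij_betw (H h) G2 G2"
    by (rule bij_betwI[where g = "H g"]) (use Hg in auto)
  have "H g x = inv_into G2 (H h) x" if "x \<in> G2" for x
    by (rule inv_into_f_eq[symmetric]) (use bijH Hg that in \<open>auto simp: bij_betw_def\<close>)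
  moreover have "holomorphic_map_on (H g) G2"
    using H_holomorphic[OF hol(2,1) into(2,1)] inv by blast
  ultimately have "holomorphic_map_on (inv_into G2 (H h)) G2"
    using holomorphic_map_on_transform open_G2 by blast
  moreover have "holomorphic_map_on (H h) G2"
    using H_holomorphic[OF hol into] inv by blast
  ultimately show ?thesis
    using bijH H_extensional by (simp add: Aut_def)
qed

theorem mainTheorem1: "Aut G2 = {H h | h. h \<in> Aut1 unit_disc}"
proof (intro equalityI subsetI)
  fix F assume F: "F \<in> Aut G2"
  then have bij: "bij_betw F G2 G2"
    by (simp add: Aut_def)
  interpret G2_biholomorphism F "inv_into G2 F"
    using F bij bij_betw_inv_into[OF bij]
    by unfold_locales (auto simp: Aut_def bij_betw_inv_into_left bij_betw_inv_into_right dest: bij_betwE)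
  \<comment> \<open>Both sides are \<open>undefined\<close> off \<open>G2\<close>, so agreement on
    \<open>G2\<close> suffices.\<close>
  have "F = H (restrict common_root unit_disc)"
    using F H_extensional F_eq_H by (intro extensionalityI[where A = G2]) (auto simp: Aut_def)
  then show "F \<in> {H h | h. h \<in> Aut1 unit_disc}"
    using restrict_common_root_Aut1 by blast
qed (use H_in_Aut in blast)

end
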